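(* Let $G$ be a group, $H$ a finite index subgroup of $G$, and $N(H)=\bigcap_{g\in G} g^{-1}Hg$. For $g\in G$ let $\pi(g)$ be the automorphism of $N(H)$ given by $\pi(g)(k)=g^{-1}kg$ for $k\in N(H)$. Consider the conditions: (i) $H$ is not icc; (ii) there exists $g\in G\setminus H$, $g\neq 1$, of finite order such that $\pi(g)$ is the identity automorphism of $N(H)$; (iii) there exists $g\in G\setminus H$, $g\neq 1$, of finite order such that $\pi(g)$ is an inner automorphism of $N(H)$. Then $G$ is not icc if and only if at least one of the conditions (i), (ii), (iii) is satisfied. Moreover, (ii) implies (iii), and (iii) implies that (i) or (ii) holds, so that $$G \text{ is not icc} \iff \text{(i) or (ii)} \iff \text{(i) or (iii)}.$$
   Context: A group is said to be icc (with infinite conjugacy classes) if it is non-trivial and all its conjugacy classes except $\{1\}$ are infinite. The subgroup $N(H)=\bigcap_{g\in G}g^{-1}Hg$ (called the "normalized" of $H$ in the source; it is the normal core of $H$ in $G$, not the normalizer) is normal in $G$, so conjugation by any $g\in G$ restricts to an automorphism of $N(H)$. "Inner automorphism of $N(H)$" means conjugation by an element of $N(H)$. *)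

theory Defs
  imports "HOL-Algebra.Bij" "HOL-Algebra.Multiplicative_Group"
begin

definition conjugacy_class :: "('a, 'b) monoid_scheme \<Rightarrow> 'a \<Rightarrow> 'a set" where
  "conjugacy_class G x = {inv\<^bsub>G\<^esub> g \<otimes>\<^bsub>G\<^esub> x \<otimes>\<^bsub>G\<^esub> g | g. g \<in> carrier G}"

definition icc :: "('a, 'b) monoid_scheme \<Rightarrow> bool" where
  "icc G \<longleftrightarrow> carrier G \<noteq> {\<one>\<^bsub>G\<^esub>} \<and>
     (\<forall>x\<in>carrier G. conjugacy_class G x \<noteq> {\<one>\<^bsub>G\<^esub>} \<longrightarrow> infinite (conjugacy_class G x))"

definition finite_index :: "'a set \<Rightarrow> ('a, 'b) monoid_scheme \<Rightarrow> bool" where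
  "finite_index H G \<longleftrightarrow> finite (rcosets\<^bsub>G\<^esub> H)"

definition normal_core :: "('a, 'b) monoid_scheme \<Rightarrow> 'a set \<Rightarrow> 'a set" where
  "normal_core G H = (\<Inter>g\<in>carrier G. (inv\<^bsub>G\<^esub> g <#\<^bsub>G\<^esub> H) #>\<^bsub>G\<^esub> g)"

abbreviation core_group :: "('a, 'b) monoid_scheme \<Rightarrow> 'a set \<Rightarrow> ('a, 'b) monoid_scheme" where
  "core_group G H \<equiv> G\<lparr>carrier := normal_core G H\<rparr>"

text \<open>Restricted to \<open>N\<close>, so that for normal \<open>N\<close> it is an element of
  \<^const>\<open>auto\<close> of \<open>N\<close>, whose elements are extensional functions.\<close>

definition conj_on :: "('a, 'b) monoid_scheme \<Rightarrow> 'a set \<Rightarrow> 'a \<Rightarrow> 'a \<Rightarrow> 'a" where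
  "conj_on G N g = (\<lambda>k\<in>N. inv\<^bsub>G\<^esub> g \<otimes>\<^bsub>G\<^esub> k \<otimes>\<^bsub>G\<^esub> g)"

definition inner_auto :: "('a, 'b) monoid_scheme \<Rightarrow> ('a \<Rightarrow> 'a) set" where
  "inner_auto K = conj_on K (carrier K) ` carrier K"

abbreviation core_conj :: "('a, 'b) monoid_scheme \<Rightarrow> 'a set \<Rightarrow> 'a \<Rightarrow> 'a \<Rightarrow> 'a" where
  "core_conj G H \<equiv> conj_on G (normal_core G H)"

text \<open>\<^const>\<open>group.ord\<close> is \<open>0\<close> exactly on the elements of infinite order.\<close>

definition finite_order :: "('a, 'b) monoid_scheme \<Rightarrow> 'a \<Rightarrow> bool" where
  "finite_order G g \<longleftrightarrow> group.ord G g \<noteq> 0"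

definition outer_torsion_acting_trivially :: "('a, 'b) monoid_scheme \<Rightarrow> 'a set \<Rightarrow> bool" where
  "outer_torsion_acting_trivially G H \<longleftrightarrow>
     (\<exists>g \<in> carrier G - H. g \<noteq> \<one>\<^bsub>G\<^esub> \<and> finite_order G g \<and>
        core_conj G H g = \<one>\<^bsub>AutoGroup (core_group G H)\<^esub>)"

definition outer_torsion_acting_innerly :: "('a, 'b) monoid_scheme \<Rightarrow> 'a set \<Rightarrow> bool" where
  "outer_torsion_acting_innerly G H \<longleftrightarrow>
     (\<exists>g \<in> carrier G - H. g \<noteq> \<one>\<^bsub>G\<^esub> \<and> finite_order G g \<and>
        core_conj G H g \<in> inner_auto (core_group G H))"

lemma one_AutoGroup: "\<one>\<^bsub>AutoGroup K\<^esub> = (\<lambda>k\<in>carrier K. k)"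
  by (simp add: AutoGroup_def BijGroup_def)

lemma (in group) mult_inv_cancel:
  assumes "x \<in> carrier G" "y \<in> carrier G"
  shows "x \<otimes> (inv x \<otimes> y) = y" "inv x \<otimes> (x \<otimes> y) = y"
proof -
  have "x \<otimes> (inv x \<otimes> y) = (x \<otimes> inv x) \<otimes> y"
    using assms by (simp only: m_assoc inv_closed)
  then show "x \<otimes> (inv x \<otimes> y) = y" using assms by simp
  have "inv x \<otimes> (x \<otimes> y) = (inv x \<otimes> x) \<otimes> y"
    using assms by (simp only: m_assoc inv_closed)
  then show "inv x \<otimes> (x \<otimes> y) = y" using assms by simp
qed

lemma (in group) mem_normal_core:
  assumes "subgroup H G"
  shows "x \<in> normal_core G H \<longleftrightarrow>
    x \<in> carrier G \<and> (\<forall>g\<in>carrier G. g \<otimes> x \<otimes> inv g \<in> H)"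
proof -
  have H: "H \<subseteq> carrier G" using assms by (rule subgroup.subset)
  have *: "x \<in> (inv g <# H) #> g \<longleftrightarrow> x \<in> carrier G \<and> g \<otimes> x \<otimes> inv g \<in> H"
    if g: "g \<in> carrier G" for g
  proof
    assume "x \<in> (inv g <# H) #> g"
    then obtain h where h: "h \<in> H" "x = inv g \<otimes> h \<otimes> g"
      by (auto simp: r_coset_def l_coset_def)
    have hc: "h \<in> carrier G" using h H by auto
    have "g \<otimes> x \<otimes> inv g = h"
      using g hc by (simp add: h(2) m_assoc mult_inv_cancel)
    with h g hc show "x \<in> carrier G \<and> g \<otimes> x \<otimes> inv g \<in> H" by simp
  next
    assume a: "x \<in> carrier G \<and> g \<otimes> x \<otimes> inv g \<in> H"
    then have "inv g \<otimes> (g \<otimes> x \<otimes> inv g) \<otimes> g \<in> (inv g <# H) #> g"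
      unfolding r_coset_def l_coset_def by blast
    moreover have "inv g \<otimes> (g \<otimes> x \<otimes> inv g) \<otimes> g = x"
      using g a by (simp add: m_assoc mult_inv_cancel)
    ultimately show "x \<in> (inv g <# H) #> g" by simp
  qed
  have "carrier G \<noteq> {}" by auto
  then show ?thesis
    unfolding normal_core_def using * by auto
qed

lemma (in group) normal_core_normal:
  assumes "subgroup H G"
  shows "normal_core G H \<lhd> G"
proof (rule normal_invI)
  note mem = mem_normal_core[OF assms]
  show "subgroup (normal_core G H) G"
  proof (rule subgroupI)
    show "normal_core G H \<subseteq> carrier G" using mem by auto
    have "\<one> \<in> normal_core G H"
      using mem subgroup.one_closed[OF assms] by simp
    then show "normal_core G H \<noteq> {}" by auto
  next
    fix a assume a: "a \<in> normal_core G H"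
    have "g \<otimes> inv a \<otimes> inv g \<in> H" if g: "g \<in> carrier G" for g
    proof -
      have "inv (g \<otimes> a \<otimes> inv g) \<in> H"
        using a g mem subgroup.m_inv_closed[OF assms] by blast
      moreover have "inv (g \<otimes> a \<otimes> inv g) = g \<otimes> inv a \<otimes> inv g"
        using a g mem by (simp add: inv_mult_group m_assoc)
      ultimately show ?thesis by simp
    qed
    then show "inv a \<in> normal_core G H" using a mem by simp
  next
    fix a b assume ab: "a \<in> normal_core G H" "b \<in> normal_core G H"
    have "g \<otimes> (a \<otimes> b) \<otimes> inv g \<in> H" if g: "g \<in> carrier G" for g
    proof -
      have "(g \<otimes> a \<otimes> inv g) \<otimes> (g \<otimes> b \<otimes> inv g) \<in> H"
        using ab g mem subgroup.m_closed[OF assms] by blast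
      moreover have "(g \<otimes> a \<otimes> inv g) \<otimes> (g \<otimes> b \<otimes> inv g) = g \<otimes> (a \<otimes> b) \<otimes> inv g"
        using ab g mem by (simp add: m_assoc mult_inv_cancel)
      ultimately show ?thesis by simp
    qed
    then show "a \<otimes> b \<in> normal_core G H" using ab mem by simp
  qed
  fix x h assume xh: "x \<in> carrier G" "h \<in> normal_core G H"
  have "g \<otimes> (x \<otimes> h \<otimes> inv x) \<otimes> inv g \<in> H" if g: "g \<in> carrier G" for g
  proof -
    have "(g \<otimes> x) \<otimes> h \<otimes> inv (g \<otimes> x) \<in> H" using xh g mem by blast
    moreover have "(g \<otimes> x) \<otimes> h \<otimes> inv (g \<otimes> x) = g \<otimes> (x \<otimes> h \<otimes> inv x) \<otimes> inv g"
      using xh g mem by (simp add: m_assoc inv_mult_group)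
    ultimately show ?thesis by simp
  qed
  then show "x \<otimes> h \<otimes> inv x \<in> normal_core G H" using xh mem by simp
qed

lemma (in group) conj_on_in_auto:
  assumes N: "N \<lhd> G" and g: "g \<in> carrier G"
  shows "conj_on G N g \<in> auto (G\<lparr>carrier := N\<rparr>)"
proof -
  have sub: "N \<subseteq> carrier G"
    using N normal_imp_subgroup subgroup.subset by blast
  have c1: "inv g \<otimes> k \<otimes> g \<in> N" if "k \<in> N" for k
    using N g that by (rule normal.inv_op_closed1)
  have c2: "g \<otimes> k \<otimes> inv g \<in> N" if "k \<in> N" for k
    using N g that by (rule normal.inv_op_closed2)
  have "bij_betw (conj_on G N g) N N"
  proof (rule bij_betw_byWitness[where f' = "\<lambda>k. g \<otimes> k \<otimes> inv g"])
    show "\<forall>k\<in>N. g \<otimes> conj_on G N g k \<otimes> inv g = k"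
      using sub g by (auto simp: conj_on_def m_assoc subset_iff mult_inv_cancel)
    show "\<forall>k\<in>N. conj_on G N g (g \<otimes> k \<otimes> inv g) = k"
      using sub g c2 by (auto simp: conj_on_def m_assoc subset_iff mult_inv_cancel)
  qed (use c1 c2 in \<open>auto simp: conj_on_def\<close>)
  moreover have "conj_on G N g \<in> hom (G\<lparr>carrier := N\<rparr>) (G\<lparr>carrier := N\<rparr>)"
  proof (rule homI)
    fix x y assume "x \<in> carrier (G\<lparr>carrier := N\<rparr>)" "y \<in> carrier (G\<lparr>carrier := N\<rparr>)"
    then have xy: "x \<in> N" "y \<in> N" "x \<in> carrier G" "y \<in> carrier G" using sub by auto
    have "x \<otimes> y \<in> N"
      using subgroup.m_closed[OF normal_imp_subgroup[OF N] xy(1,2)] .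
    moreover have "inv g \<otimes> (x \<otimes> y) \<otimes> g = (inv g \<otimes> x \<otimes> g) \<otimes> (inv g \<otimes> y \<otimes> g)"
      using xy g by (simp add: m_assoc mult_inv_cancel)
    ultimately show "conj_on G N g (x \<otimes>\<^bsub>G\<lparr>carrier := N\<rparr>\<^esub> y) =
        conj_on G N g x \<otimes>\<^bsub>G\<lparr>carrier := N\<rparr>\<^esub> conj_on G N g y"
      using xy by (simp add: conj_on_def)
  qed (use c1 in \<open>simp add: conj_on_def\<close>)
  ultimately show ?thesis
    by (simp add: auto_def Bij_def conj_on_def)
qed

end

theory Submission
  imports Defs
begin

text \<open>Let \<open>F\<close> be the set of elements of \<open>G\<close> with finite conjugacy class, a normal subgroup.
  A nontrivial \<open>G\<close> is icc iff \<open>F = 1\<close>, and since \<open>H\<close> has finite index, the corresponding subgroup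
  of \<open>H\<close> is \<open>F \<inter> H\<close>. An element centralizing the normal core \<open>N\<close>, which has finite index, lies
  in \<open>F\<close>. Suppose now that \<open>H\<close> is icc, so that \<open>F \<inter> H = 1\<close>. Every element of \<open>F\<close> is torsion, as
  one of its positive powers lies in \<open>H\<close>, and it centralizes \<open>N\<close>, as its commutators with \<open>N\<close> lie in
  \<open>F \<inter> N\<close>. If \<open>g\<close> acts on \<open>N\<close> as \<open>k \<in> N\<close> does, then \<open>g k\<inverse>\<close> centralizes \<open>N\<close>.\<close>

definition fc_center :: "('a, 'b) monoid_scheme \<Rightarrow> 'a set" where
  "fc_center G = {x \<in> carrier G. finite (conjugacy_class G x)}"

text \<open>On \<open>A\<close> the map \<open>f\<close> factors through \<open>h\<close>, the
  factor being \<open>f\<close> composed with a choice of preimage under \<open>h\<close>. This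
  serves to bound conjugates by cosets, and cosets of the core by maps on the cosets of
  \<open>H\<close>.\<close>

lemma finite_image_factor:
  assumes "finite (h ` A)" and "\<And>x y. x \<in> A \<Longrightarrow> y \<in> A \<Longrightarrow> h x = h y \<Longrightarrow> f x = f y"
  shows "finite (f ` A)"
proof -
  have "f ` A = (\<lambda>z. f (inv_into A h z)) ` h ` A"
    unfolding image_image using assms(2)
    by (intro image_cong refl) (metis f_inv_into_f image_eqI inv_into_into)
  then show ?thesis using assms(1) by simp
qed

context group
begin

section \<open>Cosets and conjugation\<close>

lemma finite_index_iff_image:
  "finite_index H G \<longleftrightarrow> finite ((\<lambda>g. H #> g) ` carrier G)"
  by (simp add: finite_index_def RCOSETS_def UNION_singleton_eq_range)

lemma r_coset_eq_iff:
  assumes "subgroup H G" "a \<in> carrier G" "b \<in> carrier G"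
  shows "H #> a = H #> b \<longleftrightarrow> a \<otimes> inv b \<in> H"
proof
  assume "H #> a = H #> b"
  then have "a \<in> H #> b" using rcos_self assms by auto
  then show "a \<otimes> inv b \<in> H" using subgroup.rcos_module_imp[OF assms(1) is_group assms(3)] by simp
next
  assume "a \<otimes> inv b \<in> H"
  then have "a \<in> H #> b" using subgroup.rcos_module_rev[OF assms(1) is_group assms(3,2)] by simp
  then show "H #> a = H #> b" using repr_independence[OF _ assms(3,1)] by simp
qed

lemma conj_eq_iff:
  assumes "g \<in> carrier G" "k \<in> carrier G" "y \<in> carrier G"
  shows "inv g \<otimes> k \<otimes> g = y \<longleftrightarrow> k \<otimes> g = g \<otimes> y"
  using assms by (metis inv_closed inv_solve_left m_assoc m_closed)

section \<open>The FC-center of a group and of its finite index subgroups\<close>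

lemma conjugacy_class_one: "conjugacy_class G \<one> = {\<one>}"
  by (auto simp: conjugacy_class_def intro!: exI[of _ \<one>])

lemma mem_conjugacy_class_self: "x \<in> carrier G \<Longrightarrow> x \<in> conjugacy_class G x"
  by (force simp: conjugacy_class_def intro: exI[of _ \<one>])

lemma one_mem_fc_center: "\<one> \<in> fc_center G"
  by (simp add: fc_center_def conjugacy_class_one)

text \<open>Since \<open>x\<close> belongs to its own class, that class is \<open>{\<one>}\<close>
  only for \<open>x = \<one>\<close>. The icc property thus splits into non-triviality and the
  absence of other finite classes.\<close>

lemma icc_iff_fc_center: "icc G \<longleftrightarrow> carrier G \<noteq> {\<one>} \<and> fc_center G = {\<one>}"
proof -
  have "conjugacy_class G x = {\<one>} \<longleftrightarrow> x = \<one>" if "x \<in> carrier G" for x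
    using mem_conjugacy_class_self[OF that] conjugacy_class_one by auto
  then show ?thesis
    using one_mem_fc_center by (auto simp: icc_def fc_center_def)
qed

text \<open>The class of an inverse consists of inverses, the class of a product lies in the product
  of the two classes, and a conjugate has no new conjugates. Finiteness passes along each
  inclusion.\<close>

lemma fc_center_normal: "fc_center G \<lhd> G"
proof (rule normal_invI)
  show "subgroup (fc_center G) G"
  proof (rule subgroupI)
    show "fc_center G \<subseteq> carrier G" by (auto simp: fc_center_def)
    show "fc_center G \<noteq> {}" using one_mem_fc_center by auto
  next
    fix a assume a: "a \<in> fc_center G"
    have "conjugacy_class G (inv a) \<subseteq> m_inv G ` conjugacy_class G a"
    proof
      fix y assume "y \<in> conjugacy_class G (inv a)"
      then obtain g where g: "g \<in> carrier G" "y = inv g \<otimes> inv a \<otimes> g"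
        by (auto simp: conjugacy_class_def)
      then have "y = inv (inv g \<otimes> a \<otimes> g)"
        using a by (simp add: fc_center_def inv_mult_group m_assoc)
      then show "y \<in> m_inv G ` conjugacy_class G a"
        using g by (auto simp: conjugacy_class_def)
    qed
    then show "inv a \<in> fc_center G"
      using a finite_subset by (auto simp: fc_center_def)
  next
    fix a b assume ab: "a \<in> fc_center G" "b \<in> fc_center G"
    have "conjugacy_class G (a \<otimes> b) \<subseteq>
        (\<lambda>(u, v). u \<otimes> v) ` (conjugacy_class G a \<times> conjugacy_class G b)"
    proof
      fix y assume "y \<in> conjugacy_class G (a \<otimes> b)"
      then obtain g where g: "g \<in> carrier G" "y = inv g \<otimes> (a \<otimes> b) \<otimes> g"
        by (auto simp: conjugacy_class_def)
      then have "y = (inv g \<otimes> a \<otimes> g) \<otimes> (inv g \<otimes> b \<otimes> g)"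
        using ab by (simp add: fc_center_def m_assoc mult_inv_cancel)
      moreover have "inv g \<otimes> a \<otimes> g \<in> conjugacy_class G a" "inv g \<otimes> b \<otimes> g \<in> conjugacy_class G b"
        using g(1) by (auto simp: conjugacy_class_def)
      ultimately show "y \<in> (\<lambda>(u, v). u \<otimes> v) ` (conjugacy_class G a \<times> conjugacy_class G b)"
        by (intro image_eqI[where x = "(inv g \<otimes> a \<otimes> g, inv g \<otimes> b \<otimes> g)"]) auto
    qed
    then show "a \<otimes> b \<in> fc_center G"
      using ab finite_subset[OF _ finite_imageI[OF finite_cartesian_product]]
      by (auto simp: fc_center_def)
  qed
next
  fix x h assume xh: "x \<in> carrier G" "h \<in> fc_center G"
  have "conjugacy_class G (x \<otimes> h \<otimes> inv x) \<subseteq> conjugacy_class G h"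
  proof
    fix y assume "y \<in> conjugacy_class G (x \<otimes> h \<otimes> inv x)"
    then obtain g where g: "g \<in> carrier G" "y = inv g \<otimes> (x \<otimes> h \<otimes> inv x) \<otimes> g"
      by (auto simp: conjugacy_class_def)
    then have "y = inv (inv x \<otimes> g) \<otimes> h \<otimes> (inv x \<otimes> g)"
      using xh by (simp add: fc_center_def m_assoc inv_mult_group)
    moreover have "inv x \<otimes> g \<in> carrier G" using xh g by simp
    ultimately show "y \<in> conjugacy_class G h"
      unfolding conjugacy_class_def by blast
  qed
  then show "x \<otimes> h \<otimes> inv x \<in> fc_center G"
    using xh finite_subset by (auto simp: fc_center_def)
qed

text \<open>If \<open>a = k \<otimes> b\<close> with \<open>k\<close> in \<open>K\<close>, then
  \<open>a\<close> and \<open>b\<close> conjugate \<open>x\<close> to the same element, because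
  \<open>k\<close> commutes with \<open>x\<close>. Hence \<open>x\<close> has at most as many
  conjugates as \<open>K\<close> has right cosets.\<close>

lemma fc_centerI:
  assumes K: "subgroup K G" "finite_index K G" and x: "x \<in> carrier G"
    and comm: "\<And>k. k \<in> K \<Longrightarrow> k \<otimes> x = x \<otimes> k"
  shows "x \<in> fc_center G"
proof -
  have "finite ((\<lambda>g. inv g \<otimes> x \<otimes> g) ` carrier G)"
  proof (rule finite_image_factor)
    show "finite ((\<lambda>g. K #> g) ` carrier G)"
      using K(2) finite_index_iff_image by blast
    fix a b assume ab: "a \<in> carrier G" "b \<in> carrier G" "K #> a = K #> b"
    define k where "k = a \<otimes> inv b"
    have k: "k \<in> K" "k \<in> carrier G"
      using ab K(1) r_coset_eq_iff by (auto simp: k_def)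
    have "a = k \<otimes> b" using ab by (simp add: k_def m_assoc)
    then have "inv a \<otimes> x \<otimes> a = inv b \<otimes> (inv k \<otimes> x \<otimes> k) \<otimes> b"
      using ab k x by (simp add: inv_mult_group m_assoc)
    also have "inv k \<otimes> x \<otimes> k = x"
      using conj_eq_iff[of k x x] comm[OF k(1)] k x by simp
    finally show "inv a \<otimes> x \<otimes> a = inv b \<otimes> x \<otimes> b" .
  qed
  moreover have "conjugacy_class G x = (\<lambda>g. inv g \<otimes> x \<otimes> g) ` carrier G"
    by (auto simp: conjugacy_class_def)
  ultimately show ?thesis using x by (simp add: fc_center_def)
qed

text \<open>The group is a finite union of cosets \<open>H #> r\<close>, and conjugating
  \<open>x\<close> by the elements of one coset yields the \<open>H\<close>-class of
  \<open>x\<close> conjugated by \<open>r\<close>. So the class of \<open>x\<close> in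
  \<open>G\<close> is finite as soon as its class in \<open>H\<close> is.\<close>

lemma fc_center_subgroup:
  assumes H: "subgroup H G" "finite_index H G"
  shows "fc_center (G\<lparr>carrier := H\<rparr>) = fc_center G \<inter> H"
proof -
  have sub: "H \<subseteq> carrier G" using H(1) by (rule subgroup.subset)
  have cl: "conjugacy_class (G\<lparr>carrier := H\<rparr>) x = (\<lambda>h. inv h \<otimes> x \<otimes> h) ` H" for x
    unfolding conjugacy_class_def Setcompr_eq_image
    using m_inv_consistent[OF H(1)] by (intro image_cong) simp_all
  have "finite (conjugacy_class G x) \<longleftrightarrow> finite ((\<lambda>h. inv h \<otimes> x \<otimes> h) ` H)"
    if "x \<in> H" for x
  proof
    have "(\<lambda>h. inv h \<otimes> x \<otimes> h) ` H \<subseteq> conjugacy_class G x"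
      using sub by (auto simp: conjugacy_class_def)
    then show "finite (conjugacy_class G x) \<Longrightarrow> finite ((\<lambda>h. inv h \<otimes> x \<otimes> h) ` H)"
      by (rule finite_subset)
  next
    assume fin: "finite ((\<lambda>h. inv h \<otimes> x \<otimes> h) ` H)"
    have x: "x \<in> carrier G" using that sub by auto
    have "finite ((\<lambda>g. inv g \<otimes> x \<otimes> g) ` C)" if "C \<in> rcosets H" for C
    proof -
      obtain r where r: "r \<in> carrier G" "C = H #> r"
        using \<open>C \<in> rcosets H\<close> by (auto simp: RCOSETS_def)
      have "inv (h \<otimes> r) \<otimes> x \<otimes> (h \<otimes> r) = inv r \<otimes> (inv h \<otimes> x \<otimes> h) \<otimes> r" if "h \<in> H" for h
        using that sub r x by (simp add: inv_mult_group m_assoc subset_iff)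
      then have "(\<lambda>g. inv g \<otimes> x \<otimes> g) ` C \<subseteq> (\<lambda>y. inv r \<otimes> y \<otimes> r) ` (\<lambda>h. inv h \<otimes> x \<otimes> h) ` H"
        by (auto simp: r(2) r_coset_def)
      then show ?thesis using fin finite_subset by blast
    qed
    then have "finite (\<Union>C\<in>rcosets H. (\<lambda>g. inv g \<otimes> x \<otimes> g) ` C)"
      using H(2) by (simp add: finite_index_def)
    moreover have "(\<Union>C\<in>rcosets H. (\<lambda>g. inv g \<otimes> x \<otimes> g) ` C) = (\<lambda>g. inv g \<otimes> x \<otimes> g) ` carrier G"
      using rcosets_part_G[OF H(1)] by blast
    moreover have "conjugacy_class G x = (\<lambda>g. inv g \<otimes> x \<otimes> g) ` carrier G"
      by (auto simp: conjugacy_class_def)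
    ultimately show "finite (conjugacy_class G x)" by simp
  qed
  then show ?thesis using sub by (auto simp: fc_center_def cl)
qed

section \<open>Finite index: the normal core and powers of an element\<close>

lemma normal_core_subset:
  assumes "subgroup H G"
  shows "normal_core G H \<subseteq> H"
  using mem_normal_core[OF assms] by (force dest: bspec[of _ _ \<one>])

text \<open>Right multiplication makes \<open>G\<close> act on the finite set of right cosets of
  \<open>H\<close>, so only finitely many maps occur. Elements inducing the same map lie in the same
  coset of the core.\<close>

lemma normal_core_finite_index:
  assumes H: "subgroup H G" "finite_index H G"
  shows "finite_index (normal_core G H) G"
  unfolding finite_index_iff_image
proof (rule finite_image_factor)
  let ?act = "\<lambda>g. \<lambda>C\<in>rcosets H. C #> g"
  have sub: "H \<subseteq> carrier G" using H(1) by (rule subgroup.subset)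
  \<comment> \<open>The restriction in \<open>?act\<close> makes these maps extensional, so that
    they lie in a finite dependent product.\<close>
  have "?act g \<in> (\<Pi>\<^sub>E C\<in>rcosets H. rcosets H)" if "g \<in> carrier G" for g
    using that sub by (auto simp: RCOSETS_def coset_mult_assoc)
  then have "?act ` carrier G \<subseteq> (\<Pi>\<^sub>E C\<in>rcosets H. rcosets H)" by blast
  then show "finite (?act ` carrier G)"
    using finite_subset[OF _ finite_PiE] H(2) unfolding finite_index_def by blast
  fix a b assume ab: "a \<in> carrier G" "b \<in> carrier G" "?act a = ?act b"
  have "g \<otimes> (a \<otimes> inv b) \<otimes> inv g \<in> H" if g: "g \<in> carrier G" for g
  proof -
    have "H #> g \<in> rcosets H" using g sub by (rule rcosetsI[rotated])
    \<comment> \<open>Equality of the two actions at the coset of \<open>g\<close> is exactly the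
      membership condition of the core for \<open>a \<otimes> inv b\<close> at
      \<open>g\<close>.\<close>
    then have "H #> g #> a = H #> g #> b" using fun_cong[OF ab(3), of "H #> g"] by simp
    then have "(g \<otimes> a) \<otimes> inv (g \<otimes> b) \<in> H"
      using ab g sub H(1) by (simp add: coset_mult_assoc r_coset_eq_iff)
    then show ?thesis using ab g by (simp add: inv_mult_group m_assoc)
  qed
  then have "a \<otimes> inv b \<in> normal_core G H"
    using ab mem_normal_core[OF H(1)] by simp
  then show "normal_core G H #> a = normal_core G H #> b"
    using ab normal_core_normal[OF H(1)] by (simp add: r_coset_eq_iff normal_imp_subgroup)
qed

text \<open>Pigeonhole: two distinct powers of \<open>x\<close> share a coset of \<open>H\<close>,
  and the difference of their exponents is the required \<open>m\<close>.\<close>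

lemma finite_index_pow_mem:
  assumes H: "subgroup H G" "finite_index H G" and x: "x \<in> carrier G"
  obtains m :: nat where "m > 0" "x [^] m \<in> H"
proof -
  have "range (\<lambda>n::nat. H #> x [^] n) \<subseteq> (\<lambda>g. H #> g) ` carrier G" using x by auto
  then have "finite (range (\<lambda>n::nat. H #> x [^] n))"
    using H(2) finite_index_iff_image finite_subset by blast
  then have "\<not> inj (\<lambda>n::nat. H #> x [^] n)" using finite_imageD by fastforce
  then obtain i j :: nat where "i < j" "H #> x [^] j = H #> x [^] i"
    using linorder_injI[of "\<lambda>n::nat. H #> x [^] n"] by (metis (no_types, lifting))
  moreover from this have "x [^] j \<otimes> inv (x [^] i) = x [^] (j - i)"
    using x by (metis inv_solve_right le_add_diff_inverse2 less_or_eq_imp_le nat_pow_closed nat_pow_mult)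
  ultimately have "j - i > 0" "x [^] (j - i) \<in> H"
    using r_coset_eq_iff[OF H(1)] x by auto
  then show thesis by (rule that)
qed

lemma finite_order_if_pow_eq_one:
  assumes "x \<in> carrier G" "m > 0" "x [^] (m::nat) = \<one>"
  shows "finite_order G x"
  using assms pow_eq_id[of x m] by (auto simp: finite_order_def)

section \<open>The action on the normal core\<close>

lemma core_conj_eq_one_iff:
  assumes H: "subgroup H G" and g: "g \<in> carrier G"
  shows "core_conj G H g = \<one>\<^bsub>AutoGroup (core_group G H)\<^esub> \<longleftrightarrow>
    (\<forall>k\<in>normal_core G H. k \<otimes> g = g \<otimes> k)"
proof -
  have "inv g \<otimes> k \<otimes> g = k \<longleftrightarrow> k \<otimes> g = g \<otimes> k" if "k \<in> normal_core G H" for k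
    using conj_eq_iff g that mem_normal_core[OF H] by auto
  then show ?thesis
    by (auto simp: one_AutoGroup conj_on_def restrict_def fun_eq_iff)
qed

lemma core_conj_eq_imp_commute:
  assumes H: "subgroup H G" and gk: "g \<in> carrier G" "k \<in> carrier G"
    and eq: "core_conj G H g = core_conj G H k" and n: "n \<in> normal_core G H"
  shows "n \<otimes> (g \<otimes> inv k) = (g \<otimes> inv k) \<otimes> n"
proof -
  have nc: "n \<in> carrier G" using n mem_normal_core[OF H] by auto
  have "inv (g \<otimes> inv k) \<otimes> n \<otimes> (g \<otimes> inv k) = k \<otimes> (inv g \<otimes> n \<otimes> g) \<otimes> inv k"
    using gk nc by (simp add: inv_mult_group m_assoc)
  also have "inv g \<otimes> n \<otimes> g = inv k \<otimes> n \<otimes> k"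
    using fun_cong[OF eq, of n] n by (simp add: conj_on_def)
  also have "k \<otimes> (inv k \<otimes> n \<otimes> k) \<otimes> inv k = n"
    using gk nc by (simp add: m_assoc mult_inv_cancel)
  finally show ?thesis using conj_eq_iff[of "g \<otimes> inv k" n n] gk nc by simp
qed

text \<open>Inverses computed in the core agree with those of \<open>G\<close>, so inner
  automorphisms of the core are the maps \<open>core_conj\<close> of its own elements.\<close>

lemma inner_auto_core_group:
  assumes "subgroup H G"
  shows "inner_auto (core_group G H) = core_conj G H ` normal_core G H"
  using m_inv_consistent[OF normal_imp_subgroup[OF normal_core_normal[OF assms]]]
  by (auto simp: inner_auto_def conj_on_def restrict_def fun_eq_iff image_iff)

section \<open>From the FC-center to the icc conditions\<close>

lemma fc_center_commute:
  assumes N: "N \<lhd> G" "fc_center G \<inter> N = {\<one>}" and x: "x \<in> fc_center G" and n: "n \<in> N"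
  shows "n \<otimes> x = x \<otimes> n"
proof -
  interpret F: normal "fc_center G" G by (rule fc_center_normal)
  interpret N: normal N G by (rule N(1))
  have c: "x \<in> carrier G" "n \<in> carrier G" using x n by auto
  \<comment> \<open>The commutator of \<open>n\<close> and \<open>x\<close> is bracketed in two
    ways: as a conjugate of \<open>inv x\<close> times \<open>x\<close> it lies in the FC-center, as
    \<open>inv n\<close> times a conjugate of \<open>n\<close> it lies in \<open>N\<close>. It is
    therefore trivial.\<close>
  have "(inv n \<otimes> inv x \<otimes> n) \<otimes> x \<in> fc_center G"
    using x c by (intro F.m_closed F.inv_op_closed1) auto
  moreover have "inv n \<otimes> (inv x \<otimes> n \<otimes> x) \<in> N"
    using n c by (intro N.m_closed N.inv_op_closed1) auto
  moreover have "(inv n \<otimes> inv x \<otimes> n) \<otimes> x = inv n \<otimes> (inv x \<otimes> n \<otimes> x)"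
    using c by (simp add: m_assoc)
  ultimately have "inv n \<otimes> (inv x \<otimes> n \<otimes> x) = \<one>" using N(2) by auto
  then have "inv x \<otimes> n \<otimes> x = n" using c by (metis inv_closed inv_solve_left' m_closed r_one)
  then show ?thesis using conj_eq_iff c by blast
qed

text \<open>Some positive power of \<open>x\<close> lies in \<open>H\<close>. It also stays in the
  FC-center, so it is in the trivial intersection.\<close>

lemma fc_center_finite_order:
  assumes H: "subgroup H G" "finite_index H G" and FH: "fc_center G \<inter> H = {\<one>}"
    and x: "x \<in> fc_center G"
  shows "finite_order G x"
proof -
  have F: "subgroup (fc_center G) G" by (rule normal_imp_subgroup[OF fc_center_normal])
  have xc: "x \<in> carrier G" using x by (simp add: fc_center_def)
  obtain m :: nat where m: "m > 0" "x [^] m \<in> H"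
    using finite_index_pow_mem[OF H xc] .
  moreover have "x [^] m \<in> fc_center G"
    using x by (induction m) (auto intro: subgroup.m_closed[OF F] subgroup.one_closed[OF F])
  ultimately have "x [^] m = \<one>" using FH by auto
  then show ?thesis using finite_order_if_pow_eq_one xc m(1) by blast
qed

lemma not_icc_if_not_icc_subgroup:
  assumes H: "subgroup H G" "finite_index H G" and "\<not> icc (G\<lparr>carrier := H\<rparr>)"
  shows "\<not> icc G"
proof (cases "H = {\<one>}")
  case True
  \<comment> \<open>A trivial \<open>H\<close> fails to be icc by definition and needs its own case.
    Every element commutes with \<open>\<one>\<close>, so finite index of \<open>{\<one>}\<close>
    puts all of \<open>G\<close> in the FC-center.\<close>
  then have "carrier G \<subseteq> fc_center G"
    using H by (auto intro: fc_centerI)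
  then show ?thesis by (auto simp: icc_iff_fc_center)
next
  case False
  then have "fc_center G \<inter> H \<noteq> {\<one>}"
    using assms(3) group.icc_iff_fc_center[OF subgroup.subgroup_is_group[OF H(1) is_group]]
      fc_center_subgroup[OF H] by simp
  moreover have "\<one> \<in> H" using H(1) by (rule subgroup.one_closed)
  ultimately show ?thesis using icc_iff_fc_center by auto
qed

lemma outer_torsion_if_fc_center:
  assumes H: "subgroup H G" "finite_index H G" and FH: "fc_center G \<inter> H = {\<one>}"
    and x: "x \<in> fc_center G" "x \<notin> H"
  shows "outer_torsion_acting_trivially G H"
proof -
  have N: "normal_core G H \<lhd> G" by (rule normal_core_normal[OF H(1)])
  have "fc_center G \<inter> normal_core G H = {\<one>}"
    using FH normal_core_subset[OF H(1)] one_mem_fc_center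
      subgroup.one_closed[OF normal_imp_subgroup[OF N]] by auto
  then have "\<forall>k\<in>normal_core G H. k \<otimes> x = x \<otimes> k"
    using fc_center_commute[OF N] x(1) by blast
  moreover have "x \<in> carrier G" using x(1) by (simp add: fc_center_def)
  moreover have "x \<noteq> \<one>" using x(2) subgroup.one_closed[OF H(1)] by auto
  ultimately show ?thesis
    using x(2) fc_center_finite_order[OF H FH x(1)] core_conj_eq_one_iff[OF H(1)]
    unfolding outer_torsion_acting_trivially_def by blast
qed

end

theorem theorem1:
  fixes G :: "('a, 'b) monoid_scheme" and H :: "'a set"
  assumes "group G" and "subgroup H G" and "finite_index H G"
  shows "(\<not> icc G \<longleftrightarrow>
           \<not> icc (G\<lparr>carrier := H\<rparr>) \<or> outer_torsion_acting_trivially G H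
             \<or> outer_torsion_acting_innerly G H)
       \<and> (outer_torsion_acting_trivially G H \<longrightarrow> outer_torsion_acting_innerly G H)
       \<and> (outer_torsion_acting_innerly G H \<longrightarrow>
           \<not> icc (G\<lparr>carrier := H\<rparr>) \<or> outer_torsion_acting_trivially G H)
       \<and> (\<not> icc G \<longleftrightarrow> \<not> icc (G\<lparr>carrier := H\<rparr>) \<or> outer_torsion_acting_trivially G H)
       \<and> (\<not> icc G \<longleftrightarrow> \<not> icc (G\<lparr>carrier := H\<rparr>) \<or> outer_torsion_acting_innerly G H)"
proof -
  interpret group G by fact
  note H = assms(2,3)
  let ?i = "\<not> icc (G\<lparr>carrier := H\<rparr>)"
  have N: "subgroup (normal_core G H) G"
    by (rule normal_imp_subgroup[OF normal_core_normal[OF H(1)]])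
  note fcI = fc_centerI[OF N normal_core_finite_index[OF H]]
  have icc_H: "H \<noteq> {\<one>\<^bsub>G\<^esub>} \<and> fc_center G \<inter> H = {\<one>\<^bsub>G\<^esub>}" if "\<not> ?i"
    using that group.icc_iff_fc_center[OF subgroup.subgroup_is_group[OF H(1) is_group]]
      fc_center_subgroup[OF H] by simp
  have "\<not> icc G" if ii: "outer_torsion_acting_trivially G H"
  proof -
    obtain g where g: "g \<in> carrier G" "g \<noteq> \<one>\<^bsub>G\<^esub>"
        "core_conj G H g = \<one>\<^bsub>AutoGroup (core_group G H)\<^esub>"
      using ii unfolding outer_torsion_acting_trivially_def by blast
    then have "g \<in> fc_center G" using fcI core_conj_eq_one_iff[OF H(1)] by blast
    then show ?thesis using g(2) icc_iff_fc_center by auto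
  qed
  moreover have "?i \<or> outer_torsion_acting_trivially G H" if "\<not> icc G"
  proof (rule ccontr)
    assume *: "\<not> (?i \<or> outer_torsion_acting_trivially G H)"
    then have "carrier G \<noteq> {\<one>\<^bsub>G\<^esub>}"
      using icc_H subgroup.subset[OF H(1)] subgroup.one_closed[OF H(1)] by blast
    then have "fc_center G \<noteq> {\<one>\<^bsub>G\<^esub>}" using that icc_iff_fc_center by simp
    then obtain x where "x \<in> fc_center G" "x \<noteq> \<one>\<^bsub>G\<^esub>"
      using one_mem_fc_center by auto
    \<comment> \<open>As the FC-center meets \<open>H\<close> trivially, \<open>x\<close> lies
      outside \<open>H\<close> and is itself a witness for (ii).\<close>
    then show False using * icc_H outer_torsion_if_fc_center[OF H] by blast
  qed
  moreover have "outer_torsion_acting_innerly G H" if "outer_torsion_acting_trivially G H"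
  proof -
    \<comment> \<open>The identity automorphism is inner, being conjugation by the neutral element;
      the same \<open>g\<close> then serves for (iii).\<close>
    have "\<one>\<^bsub>AutoGroup (core_group G H)\<^esub> = core_conj G H \<one>\<^bsub>G\<^esub>"
      using core_conj_eq_one_iff[OF H(1), of "\<one>\<^bsub>G\<^esub>"] subgroup.mem_carrier[OF N] by simp
    then have "\<one>\<^bsub>AutoGroup (core_group G H)\<^esub> \<in> inner_auto (core_group G H)"
      using inner_auto_core_group[OF H(1)] subgroup.one_closed[OF N] by simp
    then show ?thesis
      using that unfolding outer_torsion_acting_trivially_def outer_torsion_acting_innerly_def
      by fastforce
  qed
  moreover have "?i \<or> outer_torsion_acting_trivially G H" if iii: "outer_torsion_acting_innerly G H"
  proof (cases ?i)
    case True
    then show ?thesis ..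
  next
    case False
    obtain g k where g: "g \<in> carrier G" "g \<notin> H" and k: "k \<in> normal_core G H"
        and eq: "core_conj G H g = core_conj G H k"
      using iii inner_auto_core_group[OF H(1)] unfolding outer_torsion_acting_innerly_def by auto
    have kc: "k \<in> carrier G" "k \<in> H"
      using k subgroup.mem_carrier[OF N] normal_core_subset[OF H(1)] by auto
    \<comment> \<open>The witness for (ii) is \<open>g\<close> times the inverse of
      \<open>k\<close>: it centralizes the core, and it stays outside \<open>H\<close> because
      \<open>k\<close> is in \<open>H\<close>. Its finite order comes from its membership in the
      FC-center, which meets \<open>H\<close> trivially.\<close>
    have "g \<otimes>\<^bsub>G\<^esub> inv\<^bsub>G\<^esub> k \<in> fc_center G"
      using fcI core_conj_eq_imp_commute[OF H(1) g(1) kc(1) eq] g(1) kc(1) by simp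
    moreover have "g \<otimes>\<^bsub>G\<^esub> inv\<^bsub>G\<^esub> k \<notin> H"
    proof
      assume "g \<otimes>\<^bsub>G\<^esub> inv\<^bsub>G\<^esub> k \<in> H"
      then have "(g \<otimes>\<^bsub>G\<^esub> inv\<^bsub>G\<^esub> k) \<otimes>\<^bsub>G\<^esub> k \<in> H" using kc(2) subgroup.m_closed[OF H(1)] by blast
      then show False using g kc(1) by (simp add: m_assoc)
    qed
    ultimately show ?thesis
      using outer_torsion_if_fc_center[OF H] icc_H[OF False] by blast
  qed
  ultimately show ?thesis using not_icc_if_not_icc_subgroup[OF H] by blast
qed

end
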